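(* Let $0<\alpha<\infty$ and let $(J_n)_{n\ge1}$ be an $\alpha$-kernel. Let $J=\sum_{n\ge1}J_n$. For $\epsilon,\omega_A,\omega_B>0$ define $$q_0=\sqrt{\omega_A+2\epsilon J},\qquad q_n=\frac{\epsilon\left(J_nq_0+\sum_{m=1}^{n-1}(J_{n-m}+J_{n+m})q_m\right)}{\epsilon(2J-J_{2n})+\omega_A}\quad(n\ge1),$$ $$g_1=g_0=\sqrt{\omega_B+\epsilon(2J-J_1)},\qquad g_n=\frac{\epsilon\sum_{m=1}^{n-1}(J_{n-m}+J_{n+m-1})g_m}{\epsilon(2J-J_{2n-1})+\omega_B}\quad(n\ge2).$$ Then the convergence rate of $\frac{q_n}{q_0}\sim\rho J_n$ as $\rho\to0$ is uniform in $n$. More precisely, for all $\epsilon_1,\alpha>0$ there exists $\rho_*=\rho_*(\epsilon_1,\alpha)>0$ such that for any $0<\rho<\rho_*$, $$\frac1{1+\epsilon_1}<\frac{q_n/q_0}{\rho J_n}<1+\epsilon_1\qquad\text{for all }n\ge1,$$ $$\frac1{1+\epsilon_1}\le\frac{g_n/g_0}{\rho(J_n+J_{n-1})}\le1+\epsilon_1\qquad\text{for all }n\ge2 ,$$ where $\rho=\epsilon/\omega_A$ for the sequence $q$ and $\rho=\epsilon/\omega_B$ for the sequence $g$.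
   Context: For $0<\alpha<\infty$, an $\alpha$-kernel is a sequence $J_n\ge0$ ($n\ge1$), not identically zero, with $\lim_{n\to\infty}n^{1+\alpha}J_n\in(0,\infty)$. The kernel is fixed. The sequences $q$ (onsite) and $g$ (offsite) are approximate stationary profiles extended to $\mathbb{Z}$ by $q_{-n}=q_n$ and $g_n=g_{-(n-1)}$. The notation $a\sim b$ means $a/b\to1$.
   Formalization: An α-kernel may vanish at finitely many n, where the quotients have zero denominator; the bounds are therefore asserted only for those n with J_n ≠ 0 (for q) and J_n + J_{n-1} ≠ 0 (for g). *)

theory Defs
  imports "HOL-Analysis.Analysis"
begin

text \<open>
  A kernel \<open>(J\<^sub>n)\<close> with \<open>n \<ge> 1\<close> is a function on \<^typ>\<open>nat\<close> whose value at \<open>0\<close> is irrelevant: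
  no definition below refers to \<open>J 0\<close>, except inside the limit, where one index does not matter.
\<close>

definition alpha_kernel :: "real \<Rightarrow> (nat \<Rightarrow> real) \<Rightarrow> bool" where
  "alpha_kernel \<alpha> J \<longleftrightarrow>
     0 < \<alpha> \<and> (\<forall>n\<ge>1. 0 \<le> J n) \<and> (\<exists>n\<ge>1. J n \<noteq> 0) \<and>
     (\<exists>L>0. (\<lambda>n. real n powr (1 + \<alpha>) * J n) \<longlonglongrightarrow> L)"

definition kernel_sum :: "(nat \<Rightarrow> real) \<Rightarrow> real" where
  "kernel_sum J = (\<Sum>n. J (Suc n))"

lemma alpha_kernel_summable:
  assumes "alpha_kernel \<alpha> J"
  shows "summable (\<lambda>n. J (Suc n))"
proof -
  obtain L where \<alpha>: "0 < \<alpha>" and J: "\<And>n. n \<ge> 1 \<Longrightarrow> 0 \<le> J n"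
    and L: "(\<lambda>n. real n powr (1 + \<alpha>) * J n) \<longlonglongrightarrow> L"
    using assms unfolding alpha_kernel_def by blast
  from order_tendstoD(2)[OF L, of "L + 1"]
  have "\<forall>\<^sub>F n in sequentially. real n powr (1 + \<alpha>) * J n < L + 1" by simp
  then have "\<forall>\<^sub>F n in sequentially. norm (J n) \<le> (L + 1) * real n powr (- (1 + \<alpha>))"
    using eventually_ge_at_top[of 1]
  proof eventually_elim
    case (elim n)
    then have "J n < (L + 1) / real n powr (1 + \<alpha>)"
      by (simp add: pos_less_divide_eq mult.commute)
    then show ?case using J[of n] elim unfolding powr_minus_divide by simp
  qed
  moreover have "summable (\<lambda>n. (L + 1) * real n powr (- (1 + \<alpha>)))"
    using \<alpha> by (intro summable_mult) (simp add: summable_real_powr_iff)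
  ultimately have "summable J" by (rule summable_comparison_test_ev)
  then show ?thesis by (simp add: summable_Suc_iff)
qed

text \<open>
  The profiles are recorded on the indices \<open>n \<ge> 0\<close> only. The values at negative indices are the
  reflections \<open>q\<^sub>-\<^sub>n = q\<^sub>n\<close> and \<open>g\<^sub>n = g\<^sub>-\<^sub>(\<^sub>n\<^sub>-\<^sub>1\<^sub>)\<close>; the latter includes \<open>g\<^sub>0 = g\<^sub>1\<close>.
\<close>

fun onsite_profile :: "(nat \<Rightarrow> real) \<Rightarrow> real \<Rightarrow> real \<Rightarrow> nat \<Rightarrow> real" where
  "onsite_profile J \<epsilon> \<omega> n =
     (if n = 0 then sqrt (\<omega> + 2 * \<epsilon> * kernel_sum J)
      else \<epsilon> * (J n * onsite_profile J \<epsilon> \<omega> 0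
                + (\<Sum>m\<in>{1..<n}. (J (n - m) + J (n + m)) * onsite_profile J \<epsilon> \<omega> m))
           / (\<epsilon> * (2 * kernel_sum J - J (2 * n)) + \<omega>))"

fun offsite_profile :: "(nat \<Rightarrow> real) \<Rightarrow> real \<Rightarrow> real \<Rightarrow> nat \<Rightarrow> real" where
  "offsite_profile J \<epsilon> \<omega> n =
     (if n \<le> 1 then sqrt (\<omega> + \<epsilon> * (2 * kernel_sum J - J 1))
      else \<epsilon> * (\<Sum>m\<in>{1..<n}. (J (n - m) + J (n + m - 1)) * offsite_profile J \<epsilon> \<omega> m)
           / (\<epsilon> * (2 * kernel_sum J - J (2 * n - 1)) + \<omega>))"

declare onsite_profile.simps [simp del] offsite_profile.simps [simp del]

end

theory Submission
  imports Defs
begin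

text \<open>
  Put \<open>w\<^sub>n = n\<^bsup>-(1+\<alpha>)\<^esup>\<close>. The kernel satisfies \<open>J\<^sub>n \<le> C w\<^sub>n\<close>, and \<open>c w\<^sub>n \<le> J\<^sub>n\<close> whenever \<open>J\<^sub>n \<noteq> 0\<close>.
  Both normalised profiles solve a recursion \<open>r\<^sub>n = \<rho> (a\<^sub>n + \<Sum>\<^sub>m\<^sub><\<^sub>n k\<^sub>n\<^sub>m r\<^sub>m) / (1 + \<rho> b\<^sub>n)\<close> with \<open>a\<^sub>n = O(w\<^sub>n)\<close>,
  \<open>b\<^sub>n = O(1)\<close> and \<open>k\<^sub>n\<^sub>m = O(w\<^sub>n\<^sub>-\<^sub>m)\<close>. Since \<open>w * w = O(w)\<close> for the convolution, induction gives
  \<open>r\<^sub>n = O(\<rho> w\<^sub>n)\<close> for small \<open>\<rho>\<close>; feeding this bound back into the recursion yields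
  \<open>r\<^sub>n = \<rho> a\<^sub>n + O(\<rho>\<^sup>2 w\<^sub>n)\<close>, so \<open>r\<^sub>n / (\<rho> a\<^sub>n) = 1 + O(\<rho>)\<close> wherever \<open>w\<^sub>n = O(a\<^sub>n)\<close>.
\<close>

section \<open>Power-law weights and two-sided bounds for the kernel\<close>

text \<open>One of \<open>m\<close> and \<open>n - m\<close> is at least \<open>n / 2\<close>, so
  its factor is at most \<open>2 powr s * real n powr (-s)\<close>. The other factor is summable
  because \<open>1 < s\<close>.\<close>

lemma powr_convolution_le:
  assumes "1 < (s::real)"
  obtains D where "0 < D"
    and "\<And>n. (\<Sum>m\<in>{1..<n}. real (n - m) powr (-s) * real m powr (-s)) \<le> D * real n powr (-s)"
proof
  \<comment> \<open>Since \<open>0 powr (-s) = 0\<close>, the term at index 0 adds nothing to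
    \<open>suminf w\<close>.\<close>
  define w where "w n = real n powr (-s)" for n
  have sm: "summable w"
    unfolding w_def using assms by (simp add: summable_real_powr_iff)
  have w0: "0 \<le> w n" for n by (simp add: w_def)
  have "0 < w 1" by (simp add: w_def)
  then have W0: "0 < suminf w" using suminf_pos2[OF sm w0] by blast
  show "0 < 2 * (2 powr s * suminf w)" using W0 by simp
  show "(\<Sum>m\<in>{1..<n}. real (n - m) powr (-s) * real m powr (-s))
      \<le> 2 * (2 powr s * suminf w) * real n powr (-s)" for n
  proof -
    have half: "w j \<le> 2 powr s * w n" if "n \<le> 2 * j" "0 < j" "0 < n" for j
    proof -
      have "w j \<le> (real n / 2) powr (-s)"
        unfolding w_def using that assms by (intro powr_mono2') auto
      also have "\<dots> = 2 powr s * w n"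
        unfolding w_def using that by (simp add: powr_divide powr_minus field_simps)
      finally show ?thesis .
    qed
    have pt: "w (n - m) * w m \<le> 2 powr s * w n * (w m + w (n - m))" if "m \<in> {1..<n}" for m
    proof (cases "n \<le> 2 * m")
      case True
      then have "w (n - m) * w m \<le> w (n - m) * (2 powr s * w n)"
        using that w0 by (intro mult_left_mono half) auto
      also have "\<dots> \<le> (w (n - m) + w m) * (2 powr s * w n)"
        using w0 by (intro mult_right_mono) auto
      finally show ?thesis by (simp add: algebra_simps)
    next
      case False
      then have "w (n - m) * w m \<le> (2 powr s * w n) * w m"
        using that w0 by (intro mult_right_mono half) auto
      also have "\<dots> \<le> (2 powr s * w n) * (w m + w (n - m))"
        using w0 by (intro mult_left_mono) auto
      finally show ?thesis .
    qed
    have S: "(\<Sum>m\<in>{1..<n}. w m) \<le> suminf w"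
      using sm w0 by (intro sum_le_suminf) auto
    have R: "(\<Sum>m\<in>{1..<n}. w (n - m)) = (\<Sum>m\<in>{1..<n}. w m)"
      by (rule sum.reindex_bij_witness[of _ "\<lambda>m. n - m" "\<lambda>m. n - m"]) auto
    have "(\<Sum>m\<in>{1..<n}. w (n - m) * w m) \<le> (\<Sum>m\<in>{1..<n}. 2 powr s * w n * (w m + w (n - m)))"
      using pt by (rule sum_mono)
    also have "\<dots> = 2 powr s * w n * (2 * (\<Sum>m\<in>{1..<n}. w m))"
      using R by (simp add: sum_distrib_left[symmetric] sum.distrib)
    also have "\<dots> \<le> 2 powr s * w n * (2 * suminf w)"
      using S w0 by (intro mult_left_mono) auto
    finally show ?thesis by (simp add: w_def algebra_simps)
  qed
qed

text \<open>A convergent sequence is bounded, which gives \<open>C\<close>. It also eventually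
  exceeds half its positive limit, so only finitely many nonzero values remain to be compared for
  \<open>c\<close>. The lower bound must skip zeros of \<open>J\<close>, which a kernel may have at
  small indices.\<close>

lemma alpha_kernel_bounds:
  assumes "alpha_kernel \<alpha> J"
  obtains c C where "0 < c" "0 < C"
    and "\<And>n. 1 \<le> n \<Longrightarrow> J n \<le> C * real n powr (-(1 + \<alpha>))"
    and "\<And>n. 1 \<le> n \<Longrightarrow> J n \<noteq> 0 \<Longrightarrow> c * real n powr (-(1 + \<alpha>)) \<le> J n"
proof -
  define x where "x n = real n powr (1 + \<alpha>) * J n" for n
  obtain L where L: "0 < L" "x \<longlonglongrightarrow> L" and J: "\<And>n. n \<ge> 1 \<Longrightarrow> 0 \<le> J n"
    using assms unfolding alpha_kernel_def x_def by blast
  have xJ: "J n = x n * real n powr (-(1 + \<alpha>))" if "1 \<le> n" for n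
    using that unfolding powr_minus_divide x_def by simp
  obtain C where C: "0 < C" "\<And>n. norm (x n) \<le> C"
    using L(2) convergent_imp_Bseq[of x] unfolding Bseq_def convergent_def by blast
  obtain N where N: "\<And>n. N \<le> n \<Longrightarrow> L / 2 < x n"
    using order_tendstoD(1)[OF L(2), of "L / 2"] L(1) by (auto simp: eventually_sequentially)
  \<comment> \<open>Inserting \<open>L / 2\<close> keeps the set nonempty and makes
    \<open>Min F\<close> a lower bound for the tail as well.\<close>
  define F where "F = insert (L / 2) (x ` {n. 1 \<le> n \<and> n < N \<and> J n \<noteq> 0})"
  have fin: "finite F" by (simp add: F_def)
  have pos: "0 < y" if "y \<in> F" for y
  proof -
    have "0 < x n" if "1 \<le> n" "J n \<noteq> 0" for n
      using J[of n] that by (simp add: x_def)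
    then show ?thesis using that L(1) by (auto simp: F_def)
  qed
  have low: "Min F \<le> x n" if "1 \<le> n" "J n \<noteq> 0" for n
  proof (cases "n < N")
    case True
    then show ?thesis using that fin by (intro Min_le) (auto simp: F_def)
  next
    case False
    have "Min F \<le> L / 2" using fin by (intro Min_le) (auto simp: F_def)
    also have "\<dots> \<le> x n" using N[of n] False by simp
    finally show ?thesis .
  qed
  show ?thesis
  proof
    show "0 < Min F" using fin pos by (simp add: F_def)
    show "0 < C" by fact
    show "J n \<le> C * real n powr (-(1 + \<alpha>))" if "1 \<le> n" for n
      unfolding xJ[OF that] using C(2)[of n] by (intro mult_right_mono) auto
    show "Min F * real n powr (-(1 + \<alpha>)) \<le> J n" if "1 \<le> n" "J n \<noteq> 0" for n
      unfolding xJ[OF that(1)] using low[OF that] by (intro mult_right_mono) auto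
  qed
qed

lemma kernel_le_kernel_sum:
  assumes "alpha_kernel \<alpha> J" "1 \<le> n"
  shows "J n \<le> kernel_sum J"
proof -
  have "sum (\<lambda>n. J (Suc n)) {n - 1} \<le> kernel_sum J"
    unfolding kernel_sum_def using assms
    by (intro sum_le_suminf alpha_kernel_summable) (auto simp: alpha_kernel_def)
  then show ?thesis using assms(2) by simp
qed

section \<open>Perturbation estimate for the abstract recursion\<close>

text \<open>The three smallness conditions serve, in order, to close the a priori induction, to
  control the denominator (lower bound) and to control the memory sum (upper bound). The recursion
  is required at every index, but comparability of \<open>a\<close> with \<open>w\<close> only at
  the index of the conclusion, so \<open>a\<close> may vanish elsewhere.\<close>

lemma volterra_recursion_ratio:
  fixes a b r w :: "nat \<Rightarrow> real" and k :: "nat \<Rightarrow> nat \<Rightarrow> real"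
  assumes pos: "0 < A" "0 < C" "0 < D" "0 < c" "0 < \<rho>"
    and small: "2 * C * D * \<rho> \<le> 1" "B * \<rho> < \<delta>" "2 * A * C * D * \<rho> < \<delta> * c"
    and w: "\<And>n. 1 \<le> n \<Longrightarrow> 0 < w n"
    and conv: "\<And>n. (\<Sum>m\<in>{1..<n}. w (n - m) * w m) \<le> D * w n"
    and a: "\<And>n. 1 \<le> n \<Longrightarrow> 0 \<le> a n" "\<And>n. 1 \<le> n \<Longrightarrow> a n \<le> A * w n"
    and b: "\<And>n. 1 \<le> n \<Longrightarrow> 0 \<le> b n" "\<And>n. 1 \<le> n \<Longrightarrow> b n \<le> B"
    and k: "\<And>n m. 1 \<le> m \<Longrightarrow> m < n \<Longrightarrow> 0 \<le> k n m"
      "\<And>n m. 1 \<le> m \<Longrightarrow> m < n \<Longrightarrow> k n m \<le> C * w (n - m)"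
    and rec: "\<And>n. 1 \<le> n \<Longrightarrow> r n = \<rho> * (a n + (\<Sum>m\<in>{1..<n}. k n m * r m)) / (1 + \<rho> * b n)"
    and n: "1 \<le> n" "c * w n \<le> a n"
  shows "1 / (1 + \<delta>) < r n / (\<rho> * a n)" "r n / (\<rho> * a n) < 1 + \<delta>"
proof -
  \<comment> \<open>This is used twice: with the induction hypothesis for the a priori bound, and
    then with that bound itself to see that the sum is of higher order in
    \<open>\<rho>\<close>.\<close>
  have step: "0 \<le> (\<Sum>m\<in>{1..<n}. k n m * r m) \<and>
      (\<Sum>m\<in>{1..<n}. k n m * r m) \<le> 2 * A * C * D * \<rho> * w n"
    if "\<And>m. 1 \<le> m \<Longrightarrow> m < n \<Longrightarrow> 0 \<le> r m \<and> r m \<le> 2 * A * \<rho> * w m" for n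
  proof
    show "0 \<le> (\<Sum>m\<in>{1..<n}. k n m * r m)"
      using that k(1) by (intro sum_nonneg mult_nonneg_nonneg) auto
    have "(\<Sum>m\<in>{1..<n}. k n m * r m) \<le> (\<Sum>m\<in>{1..<n}. (C * w (n - m)) * (2 * A * \<rho> * w m))"
      using that k pos w by (intro sum_mono mult_mono) (auto intro!: mult_nonneg_nonneg less_imp_le)
    also have "\<dots> = 2 * A * C * \<rho> * (\<Sum>m\<in>{1..<n}. w (n - m) * w m)"
      by (simp add: sum_distrib_left algebra_simps)
    also have "\<dots> \<le> 2 * A * C * \<rho> * (D * w n)"
      using conv pos by (intro mult_left_mono) auto
    finally show "(\<Sum>m\<in>{1..<n}. k n m * r m) \<le> 2 * A * C * D * \<rho> * w n"
      by (simp add: algebra_simps)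
  qed
  have apriori: "0 \<le> r n \<and> r n \<le> 2 * A * \<rho> * w n" if "1 \<le> n" for n
    using that
  proof (induction n rule: less_induct)
    case (less n)
    define S where "S = (\<Sum>m\<in>{1..<n}. k n m * r m)"
    have S: "0 \<le> S" "S \<le> 2 * A * C * D * \<rho> * w n"
      using step less.IH unfolding S_def by blast+
    \<comment> \<open>The memory sum is at most \<open>A * w n\<close>, as much as the bound on
      \<open>a n\<close>; hence the factor 2 in the a priori bound.\<close>
    have "2 * C * D * \<rho> * (A * w n) \<le> 1 * (A * w n)"
      using small(1) pos w[OF less.prems] by (intro mult_right_mono) auto
    with S a[OF less.prems] have "a n + S \<le> 2 * A * w n" by (simp add: algebra_simps)
    moreover have "(a n + S) * \<rho> / (1 + \<rho> * b n) \<le> (a n + S) * \<rho> / 1"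
      using S a[OF less.prems] b[OF less.prems] pos
      by (intro divide_left_mono) (auto simp: add_pos_nonneg)
    ultimately have "r n \<le> \<rho> * (2 * A * w n)"
      using rec[OF less.prems] pos mult_left_mono[of "a n + S" "2 * A * w n" \<rho>]
      unfolding S_def[symmetric] by (simp add: algebra_simps)
    moreover have "0 \<le> r n"
      using rec[OF less.prems] S a[OF less.prems] b[OF less.prems] pos
      unfolding S_def[symmetric] by simp
    ultimately show ?case by (simp add: algebra_simps)
  qed
  define S where "S = (\<Sum>m\<in>{1..<n}. k n m * r m)"
  have S: "0 \<le> S" "S \<le> 2 * A * C * D * \<rho> * w n"
    using step[of n] apriori unfolding S_def by blast+
  have wn: "0 < w n" and an: "0 < a n"
    using w[OF n(1)] n(2) pos mult_pos_pos[of c "w n"] by linarith+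
  have \<rho>b: "0 \<le> \<rho> * b n" "\<rho> * b n \<le> B * \<rho>"
    using b[OF n(1)] pos by (auto simp: mult.commute)
  \<comment> \<open>In this exact formula, dropping \<open>S\<close> gives the lower bound and
    dropping \<open>\<rho> * b n\<close> the upper one.\<close>
  have ratio: "r n / (\<rho> * a n) = (1 + S / a n) / (1 + \<rho> * b n)"
  proof -
    have "r n / (\<rho> * a n) = \<rho> * (a n + S) / (\<rho> * a n) / (1 + \<rho> * b n)"
      using rec[OF n(1)] unfolding S_def[symmetric] by (simp add: mult.commute)
    then show ?thesis using pos an by (simp add: add_divide_distrib)
  qed
  have "1 / (1 + \<delta>) < 1 / (1 + \<rho> * b n)"
    using small(2) \<rho>b by (intro divide_strict_left_mono) auto
  also have "\<dots> \<le> (1 + S / a n) / (1 + \<rho> * b n)"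
    using S an \<rho>b by (intro divide_right_mono) auto
  finally show "1 / (1 + \<delta>) < r n / (\<rho> * a n)" unfolding ratio .
  \<comment> \<open>Positivity of \<open>\<delta>\<close> follows from
    \<open>0 \<le> \<rho> * b n \<le> B * \<rho> < \<delta>\<close>.\<close>
  have \<delta>: "0 < \<delta>" using small(2) \<rho>b by linarith
  have "S < \<delta> * c * w n" using S(2) mult_strict_right_mono[OF small(3) wn] by linarith
  also have "\<dots> \<le> \<delta> * a n" using \<delta> n(2) by (simp add: mult.assoc)
  finally have Sa: "S / a n < \<delta>" using an by (simp add: field_simps)
  have "(1 + S / a n) / (1 + \<rho> * b n) \<le> (1 + S / a n) / 1"
    using S an \<rho>b by (intro divide_left_mono) auto
  then show "r n / (\<rho> * a n) < 1 + \<delta>" using Sa unfolding ratio by simp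
qed

section \<open>Recursions for the normalised profiles\<close>

text \<open>Dividing numerator and denominator by \<open>\<omega>\<close> leaves only the quotient
  \<open>\<epsilon> / \<omega>\<close>, so a threshold on it can be uniform in both
  parameters.\<close>

lemma onsite_ratio_rec:
  assumes "alpha_kernel \<alpha> J" "0 < \<epsilon>" "0 < \<omega>" "1 \<le> n"
  shows "onsite_profile J \<epsilon> \<omega> n / onsite_profile J \<epsilon> \<omega> 0
    = \<epsilon> / \<omega> * (J n + (\<Sum>m\<in>{1..<n}. (J (n - m) + J (n + m)) *
          (onsite_profile J \<epsilon> \<omega> m / onsite_profile J \<epsilon> \<omega> 0)))
      / (1 + \<epsilon> / \<omega> * (2 * kernel_sum J - J (2 * n)))"
proof -
  let ?q = "onsite_profile J \<epsilon> \<omega>"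
  have K: "0 \<le> J (2 * n)" "J (2 * n) \<le> kernel_sum J"
    using assms kernel_le_kernel_sum[OF assms(1), of "2 * n"] by (auto simp: alpha_kernel_def)
  then have q0: "?q 0 > 0"
    using assms by (simp add: onsite_profile.simps[of J \<epsilon> \<omega> 0] add_pos_nonneg)
  have "0 < \<epsilon> * (2 * kernel_sum J - J (2 * n)) + \<omega>"
    using assms K by (intro add_nonneg_pos mult_nonneg_nonneg) auto
  then have scale: "\<epsilon> * X / (\<epsilon> * (2 * kernel_sum J - J (2 * n)) + \<omega>)
      = \<epsilon> / \<omega> * X / (1 + \<epsilon> / \<omega> * (2 * kernel_sum J - J (2 * n)))" for X
    using assms(3) by (simp add: divide_simps add.commute)
  have "?q n / ?q 0 = \<epsilon> * ((J n * ?q 0 + (\<Sum>m\<in>{1..<n}. (J (n - m) + J (n + m)) * ?q m)) / ?q 0)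
      / (\<epsilon> * (2 * kernel_sum J - J (2 * n)) + \<omega>)"
    using assms(4) by (subst onsite_profile.simps[of J \<epsilon> \<omega> n]) simp
  then show ?thesis
    unfolding scale using q0 by (simp add: add_divide_distrib sum_divide_distrib)
qed

text \<open>Because \<open>g\<^sub>1 = g\<^sub>0\<close>, the summand at \<open>m = 1\<close>
  becomes the source \<open>J n + J (n - 1)\<close>, and the remaining sum starts at 2.\<close>

lemma offsite_ratio_rec:
  assumes "alpha_kernel \<alpha> J" "0 < \<epsilon>" "0 < \<omega>" "2 \<le> n"
  shows "offsite_profile J \<epsilon> \<omega> n / offsite_profile J \<epsilon> \<omega> 0
    = \<epsilon> / \<omega> * (J n + J (n - 1) + (\<Sum>m\<in>{2..<n}. (J (n - m) + J (n + m - 1)) *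
          (offsite_profile J \<epsilon> \<omega> m / offsite_profile J \<epsilon> \<omega> 0)))
      / (1 + \<epsilon> / \<omega> * (2 * kernel_sum J - J (2 * n - 1)))"
proof -
  let ?g = "offsite_profile J \<epsilon> \<omega>"
  have K: "0 \<le> J m" "J m \<le> kernel_sum J" if "1 \<le> m" for m
    using assms that kernel_le_kernel_sum[OF assms(1), of m] by (auto simp: alpha_kernel_def)
  have nn: "0 \<le> 2 * kernel_sum J - J m" if "1 \<le> m" for m
    using K[OF that] by linarith
  have g0: "?g 0 > 0"
    using assms nn[of 1] by (simp add: offsite_profile.simps[of J \<epsilon> \<omega> 0] add_pos_nonneg)
  have g1: "?g (Suc 0) = ?g 0"
    by (simp add: offsite_profile.simps[of J \<epsilon> \<omega> 0] offsite_profile.simps[of J \<epsilon> \<omega> "Suc 0"])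
  have "0 < \<epsilon> * (2 * kernel_sum J - J (2 * n - 1)) + \<omega>"
    using assms nn[of "2 * n - 1"] by (intro add_nonneg_pos mult_nonneg_nonneg) auto
  then have scale: "\<epsilon> * X / (\<epsilon> * (2 * kernel_sum J - J (2 * n - 1)) + \<omega>)
      = \<epsilon> / \<omega> * X / (1 + \<epsilon> / \<omega> * (2 * kernel_sum J - J (2 * n - 1)))" for X
    using assms(3) by (simp add: divide_simps add.commute)
  have split: "{1..<n} = insert 1 {2..<n}" using assms(4) by auto
  have "?g n / ?g 0 = \<epsilon> * ((\<Sum>m\<in>{1..<n}. (J (n - m) + J (n + m - 1)) * ?g m) / ?g 0)
      / (\<epsilon> * (2 * kernel_sum J - J (2 * n - 1)) + \<omega>)"
    using assms(4) by (subst offsite_profile.simps[of J \<epsilon> \<omega> n]) simp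
  also have "(\<Sum>m\<in>{1..<n}. (J (n - m) + J (n + m - 1)) * ?g m) / ?g 0
      = J n + J (n - 1) + (\<Sum>m\<in>{2..<n}. (J (n - m) + J (n + m - 1)) * (?g m / ?g 0))"
    unfolding split using g0 g1 by (simp add: add_divide_distrib sum_divide_distrib)
  finally show ?thesis unfolding scale .
qed

section \<open>Uniform asymptotics of both profiles\<close>

text \<open>The conditions \<open>J n \<noteq> 0\<close> and
  \<open>J n + J (n - 1) \<noteq> 0\<close> exclude quotients with denominator 0, which evaluate to
  0 in HOL and would violate the lower bounds.\<close>

theorem proposition5p4:
  fixes \<alpha> :: real and J :: "nat \<Rightarrow> real"
  assumes "0 < \<alpha>" and "alpha_kernel \<alpha> J"
  shows "\<forall>\<epsilon>\<^sub>1>0. \<exists>\<rho>\<^sub>0>0. \<forall>\<rho>. 0 < \<rho> \<and> \<rho> < \<rho>\<^sub>0 \<longrightarrow>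
    (\<forall>\<epsilon> \<omega>\<^sub>A. 0 < \<epsilon> \<and> 0 < \<omega>\<^sub>A \<and> \<rho> = \<epsilon> / \<omega>\<^sub>A \<longrightarrow>
       (\<forall>n\<ge>1. J n \<noteq> 0 \<longrightarrow>
          1 / (1 + \<epsilon>\<^sub>1)
            < (onsite_profile J \<epsilon> \<omega>\<^sub>A n / onsite_profile J \<epsilon> \<omega>\<^sub>A 0) / (\<rho> * J n) \<and>
          (onsite_profile J \<epsilon> \<omega>\<^sub>A n / onsite_profile J \<epsilon> \<omega>\<^sub>A 0) / (\<rho> * J n)
            < 1 + \<epsilon>\<^sub>1)) \<and>
    (\<forall>\<epsilon> \<omega>\<^sub>B. 0 < \<epsilon> \<and> 0 < \<omega>\<^sub>B \<and> \<rho> = \<epsilon> / \<omega>\<^sub>B \<longrightarrow>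
       (\<forall>n\<ge>2. J n + J (n - 1) \<noteq> 0 \<longrightarrow>
          1 / (1 + \<epsilon>\<^sub>1)
            \<le> (offsite_profile J \<epsilon> \<omega>\<^sub>B n / offsite_profile J \<epsilon> \<omega>\<^sub>B 0) / (\<rho> * (J n + J (n - 1))) \<and>
          (offsite_profile J \<epsilon> \<omega>\<^sub>B n / offsite_profile J \<epsilon> \<omega>\<^sub>B 0) / (\<rho> * (J n + J (n - 1)))
            \<le> 1 + \<epsilon>\<^sub>1))"
proof (intro allI impI)
  fix \<delta> :: real
  assume \<delta>: "0 < \<delta>"
  define w where "w n = real n powr (-(1 + \<alpha>))" for n
  obtain D where D: "0 < D" "\<And>n. (\<Sum>m\<in>{1..<n}. w (n - m) * w m) \<le> D * w n"
    using powr_convolution_le[of "1 + \<alpha>"] assms(1) unfolding w_def by auto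
  obtain c C where cC: "0 < c" "0 < C" and up: "\<And>n. 1 \<le> n \<Longrightarrow> J n \<le> C * w n"
    and low: "\<And>n. 1 \<le> n \<Longrightarrow> J n \<noteq> 0 \<Longrightarrow> c * w n \<le> J n"
    using alpha_kernel_bounds[OF assms(2)] unfolding w_def by metis
  have J0: "0 \<le> J n" if "1 \<le> n" for n
    using assms(2) that by (simp add: alpha_kernel_def)
  have JK: "J n \<le> kernel_sum J" if "1 \<le> n" for n
    using kernel_le_kernel_sum[OF assms(2) that] .
  have w_pos: "0 < w n" if "1 \<le> n" for n using that by (simp add: w_def)
  have w_anti: "w n \<le> w m" if "1 \<le> m" "m \<le> n" for m n
    unfolding w_def using that assms(1) by (intro powr_mono2') auto
  \<comment> \<open>One constant for both sources: \<open>C\<close> suffices for \<open>J n\<close>,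
    and the summand with \<open>2 powr (1 + \<alpha>)\<close> pays for the shifted term
    \<open>J (n - 1)\<close>.\<close>
  define A where "A = C * (1 + 2 powr (1 + \<alpha>))"
  have CA: "C \<le> A" and A: "0 < A" using cC by (simp_all add: A_def add_pos_pos)
  have w_shift: "w (n - 1) \<le> 2 powr (1 + \<alpha>) * w n" if "2 \<le> n" for n
  proof -
    have "w (n - 1) \<le> (real n / 2) powr (-(1 + \<alpha>))"
      unfolding w_def using that assms(1) by (intro powr_mono2') auto
    also have "\<dots> = 2 powr (1 + \<alpha>) * w n"
      unfolding w_def powr_divide powr_minus by (simp add: field_simps)
    finally show ?thesis .
  qed
  \<comment> \<open>Applied with \<open>i = n - m\<close> and \<open>j = n + m\<close> or
    \<open>j = n + m - 1\<close>: the reflected term is dominated by the direct one, at the price of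
    doubling \<open>C\<close>.\<close>
  have kernel_add: "0 \<le> J i + J j \<and> J i + J j \<le> 2 * C * w i" if "1 \<le> i" "i \<le> j" for i j
  proof -
    have "C * w j \<le> C * w i" using w_anti[OF that] cC by simp
    then show ?thesis using up[of i] up[of j] J0[of i] J0[of j] that by auto
  qed
  have b: "0 \<le> 2 * kernel_sum J - J n" "2 * kernel_sum J - J n \<le> 2 * kernel_sum J" if "1 \<le> n" for n
    using J0[OF that] JK[OF that] by auto
  have K: "0 \<le> kernel_sum J" using b[of 1] by simp
  \<comment> \<open>Chosen so that \<open>\<rho> < 1 / M\<close> yields all three smallness
    conditions, with \<open>2 * C\<close> as kernel constant and \<open>2 * kernel_sum J\<close> as
    bound for \<open>b\<close>.\<close>
  define M where "M = 4 * C * D + (2 * kernel_sum J + 4 * A * C * D / c) / \<delta>"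
  have M: "0 < M" "4 * C * D \<le> M" "2 * kernel_sum J \<le> M * \<delta>" "4 * A * C * D \<le> M * \<delta> * c"
  proof -
    have p: "0 < 4 * C * D" "0 \<le> 4 * A * C * D / c" using cC D A by simp_all
    then have "0 \<le> (2 * kernel_sum J + 4 * A * C * D / c) / \<delta>" using K \<delta> by simp
    then show "0 < M" "4 * C * D \<le> M" using p by (auto simp: M_def)
    have "M * \<delta> = 4 * C * D * \<delta> + 2 * kernel_sum J + 4 * A * C * D / c"
      using \<delta> unfolding M_def distrib_right[of "4 * C * D"] by simp
    moreover have "0 \<le> 4 * C * D * \<delta>" using p \<delta> by simp
    ultimately have "2 * kernel_sum J \<le> M * \<delta>" "4 * A * C * D / c \<le> M * \<delta>" using p K by auto
    then show "2 * kernel_sum J \<le> M * \<delta>" "4 * A * C * D \<le> M * \<delta> * c"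
      using cC by (simp_all add: pos_divide_le_eq)
  qed
  have conclude: "1 / (1 + \<delta>) < r n / (\<rho> * a n) \<and> r n / (\<rho> * a n) < 1 + \<delta>"
    if \<rho>: "0 < \<rho>" "\<rho> < 1 / M"
      and a: "\<And>n. 1 \<le> n \<Longrightarrow> 0 \<le> a n" "\<And>n. 1 \<le> n \<Longrightarrow> a n \<le> A * w n"
      and bb: "\<And>n. 1 \<le> n \<Longrightarrow> 0 \<le> b n" "\<And>n. 1 \<le> n \<Longrightarrow> b n \<le> 2 * kernel_sum J"
      and k: "\<And>n m. 1 \<le> m \<Longrightarrow> m < n \<Longrightarrow> 0 \<le> k n m \<and> k n m \<le> 2 * C * w (n - m)"
      and rec: "\<And>n. 1 \<le> n \<Longrightarrow> r n = \<rho> * (a n + (\<Sum>m\<in>{1..<n}. k n m * r m)) / (1 + \<rho> * b n)"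
      and n: "1 \<le> n" "c * w n \<le> a n"
    for \<rho> a b k r n
  proof -
    have M\<rho>: "M * \<rho> < 1" using \<rho> M(1) by (simp add: field_simps)
    have "4 * C * D * \<rho> \<le> M * \<rho>" using M(2) \<rho>(1) by (rule mult_right_mono[OF _ less_imp_le])
    then have s1: "2 * (2 * C) * D * \<rho> \<le> 1" using M\<rho> by simp
    have "2 * kernel_sum J * \<rho> \<le> M * \<delta> * \<rho>" using M(3) \<rho>(1) by (rule mult_right_mono[OF _ less_imp_le])
    also have "\<dots> < \<delta>" using mult_strict_right_mono[OF M\<rho> \<delta>] by (simp add: mult_ac)
    finally have s2: "2 * kernel_sum J * \<rho> < \<delta>" .
    have "4 * A * C * D * \<rho> \<le> M * \<delta> * c * \<rho>" using M(4) \<rho>(1) by (rule mult_right_mono[OF _ less_imp_le])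
    also have "\<dots> < \<delta> * c"
      using mult_strict_right_mono[OF M\<rho> mult_pos_pos[OF \<delta> cC(1)]] by (simp add: mult_ac)
    finally have s3: "2 * A * (2 * C) * D * \<rho> < \<delta> * c" by simp
    show ?thesis
      using volterra_recursion_ratio[of A "2 * C" D c \<rho> "2 * kernel_sum J" \<delta> w a b k r n]
        A cC D \<rho> s1 s2 s3 w_pos a bb k rec n by simp
  qed
  show "\<exists>\<rho>\<^sub>0>0. \<forall>\<rho>. 0 < \<rho> \<and> \<rho> < \<rho>\<^sub>0 \<longrightarrow>
    (\<forall>\<epsilon> \<omega>\<^sub>A. 0 < \<epsilon> \<and> 0 < \<omega>\<^sub>A \<and> \<rho> = \<epsilon> / \<omega>\<^sub>A \<longrightarrow>
       (\<forall>n\<ge>1. J n \<noteq> 0 \<longrightarrow>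
          1 / (1 + \<delta>)
            < (onsite_profile J \<epsilon> \<omega>\<^sub>A n / onsite_profile J \<epsilon> \<omega>\<^sub>A 0) / (\<rho> * J n) \<and>
          (onsite_profile J \<epsilon> \<omega>\<^sub>A n / onsite_profile J \<epsilon> \<omega>\<^sub>A 0) / (\<rho> * J n)
            < 1 + \<delta>)) \<and>
    (\<forall>\<epsilon> \<omega>\<^sub>B. 0 < \<epsilon> \<and> 0 < \<omega>\<^sub>B \<and> \<rho> = \<epsilon> / \<omega>\<^sub>B \<longrightarrow>
       (\<forall>n\<ge>2. J n + J (n - 1) \<noteq> 0 \<longrightarrow>
          1 / (1 + \<delta>)
            \<le> (offsite_profile J \<epsilon> \<omega>\<^sub>B n / offsite_profile J \<epsilon> \<omega>\<^sub>B 0) / (\<rho> * (J n + J (n - 1))) \<and>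
          (offsite_profile J \<epsilon> \<omega>\<^sub>B n / offsite_profile J \<epsilon> \<omega>\<^sub>B 0) / (\<rho> * (J n + J (n - 1)))
            \<le> 1 + \<delta>))"
  proof (intro exI[of _ "1 / M"] conjI allI impI; (elim conjE)?)
    show "0 < 1 / M" using M by simp
  next
    fix \<rho> \<epsilon> \<omega> :: real and n :: nat
    assume h: "0 < \<rho>" "\<rho> < 1 / M" "0 < \<epsilon>" "0 < \<omega>" "\<rho> = \<epsilon> / \<omega>" "1 \<le> n" "J n \<noteq> 0"
    let ?q = "onsite_profile J \<epsilon> \<omega>"
    have "1 / (1 + \<delta>) < (?q n / ?q 0) / (\<rho> * J n) \<and> (?q n / ?q 0) / (\<rho> * J n) < 1 + \<delta>"
    proof (rule conclude[where r = "\<lambda>n. ?q n / ?q 0" and a = J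
          and b = "\<lambda>n. 2 * kernel_sum J - J (2 * n)" and k = "\<lambda>n m. J (n - m) + J (n + m)"])
      show "J m \<le> A * w m" if "1 \<le> m" for m
        using up[OF that] mult_right_mono[OF CA, of "w m"] w_pos[OF that] by linarith
      show "?q m / ?q 0 = \<rho> * (J m + (\<Sum>i\<in>{1..<m}. (J (m - i) + J (m + i)) * (?q i / ?q 0)))
          / (1 + \<rho> * (2 * kernel_sum J - J (2 * m)))" if "1 \<le> m" for m
        using onsite_ratio_rec[OF assms(2) h(3,4) that] h(5) by simp
      show "c * w n \<le> J n" using low h by simp
    qed (use h J0 b kernel_add in auto)
    then show "1 / (1 + \<delta>) < (?q n / ?q 0) / (\<rho> * J n)" "(?q n / ?q 0) / (\<rho> * J n) < 1 + \<delta>"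
      by auto
  next
    fix \<rho> \<epsilon> \<omega> :: real and n :: nat
    assume h: "0 < \<rho>" "\<rho> < 1 / M" "0 < \<epsilon>" "0 < \<omega>" "\<rho> = \<epsilon> / \<omega>" "2 \<le> n" "J n + J (n - 1) \<noteq> 0"
    let ?g = "offsite_profile J \<epsilon> \<omega>"
    \<comment> \<open>The entry \<open>g\<^sub>1 / g\<^sub>0 = 1\<close> is not small; its contribution is the inhomogeneity \<open>a\<close>,
      so the unknown of the recursion is set to \<open>0\<close> there.\<close>
    define a where "a n = (if n \<le> 1 then 0 else J n + J (n - 1))" for n
    define r where "r n = (if n \<le> 1 then 0 else ?g n / ?g 0)" for n
    have "1 / (1 + \<delta>) < r n / (\<rho> * a n) \<and> r n / (\<rho> * a n) < 1 + \<delta>"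
    proof (rule conclude[where r = r and a = a
          and b = "\<lambda>n. 2 * kernel_sum J - J (2 * n - 1)" and k = "\<lambda>n m. J (n - m) + J (n + m - 1)"])
      show "0 \<le> a m" for m using J0 by (auto simp: a_def)
      show "a m \<le> A * w m" if "1 \<le> m" for m
      proof (cases "m = 1")
        case True
        then show ?thesis using A w_pos[of m] by (simp add: a_def)
      next
        case False
        then have m: "2 \<le> m" using that by simp
        have "J (m - 1) \<le> C * w (m - 1)" using up m by simp
        also have "\<dots> \<le> C * (2 powr (1 + \<alpha>) * w m)" using w_shift[OF m] cC by simp
        finally show ?thesis using up[of m] m by (simp add: a_def A_def algebra_simps)
      qed
      show "r m = \<rho> * (a m + (\<Sum>i\<in>{1..<m}. (J (m - i) + J (m + i - 1)) * r i))
          / (1 + \<rho> * (2 * kernel_sum J - J (2 * m - 1)))" if "1 \<le> m" for m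
      proof (cases "m = 1")
        \<comment> \<open>At index 1 the source is 0 and the sum is empty, so the recursion forces
          the value 0 assigned to \<open>r\<close>.\<close>
        case True
        then show ?thesis by (simp add: a_def r_def)
      next
        case False
        then have m: "2 \<le> m" using that by simp
        \<comment> \<open>The summand at \<open>i = 1\<close> vanishes since \<open>r 1 = 0\<close>;
          its true contribution already sits in \<open>a m\<close>.\<close>
        have "(\<Sum>i\<in>{1..<m}. (J (m - i) + J (m + i - 1)) * r i)
            = (\<Sum>i\<in>{2..<m}. (J (m - i) + J (m + i - 1)) * (?g i / ?g 0))"
          by (rule sum.mono_neutral_cong_right) (auto simp: r_def)
        then show ?thesis
          using offsite_ratio_rec[OF assms(2) h(3,4) m] h(5) m by (simp add: a_def r_def)
      qed
      \<comment> \<open>At least one of \<open>J n\<close> and \<open>J (n - 1)\<close> is nonzero.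
        If only the latter is, its lower bound in terms of \<open>w (n - 1)\<close> is even
        stronger, as \<open>w\<close> decreases.\<close>
      show "c * w n \<le> a n"
      proof (cases "J n = 0")
        case True
        have "c * w n \<le> c * w (n - 1)" using w_anti[of "n - 1" n] h(6) cC by simp
        also have "\<dots> \<le> J (n - 1)" using low[of "n - 1"] True h(6,7) by simp
        finally show ?thesis using True h(6) by (simp add: a_def)
      next
        case False
        moreover have "0 \<le> J (n - 1)" using J0 h(6) by simp
        ultimately show ?thesis using low[of n] h(6) by (simp add: a_def)
      qed
    qed (use h b kernel_add in auto)
    then show "1 / (1 + \<delta>) \<le> (?g n / ?g 0) / (\<rho> * (J n + J (n - 1)))"
      "(?g n / ?g 0) / (\<rho> * (J n + J (n - 1))) \<le> 1 + \<delta>"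
      using h(6) by (auto simp: a_def r_def)
  qed
qed

end
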